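(* Let $\mathbb{E}=\mathbb{R}$ or $\mathbb{E}=\mathbb{C}$, let $m\ge 1$ be an integer and $N=m+1$. A sequence $\{f_k\}_{k=1}^N$ of vectors in $\mathbb{E}^m$ is an optimal Grassmannian frame for $\mathbb{E}^m$ if and only if it is a uniform tight frame for $\mathbb{E}^m$.
   Context: A frame $\{f_k\}_{k=1}^N$ for $\mathbb{E}^m$ is a finite sequence of vectors for which there exist constants $A,B>0$ with $A\|f\|^2\le\sum_{k=1}^N|\langle f,f_k\rangle|^2\le B\|f\|^2$ for all $f\in\mathbb{E}^m$. It is tight if one can take $A=B$, and uniform if $\|f_k\|=1$ for all $k$. An optimal Grassmannian frame for $\mathbb{E}^m$ (with $N$ elements, $N\ge2$) is a uniform frame $\{f_k\}_{k=1}^N$ for $\mathbb{E}^m$ satisfying $\max_{k\ne l}|\langle f_k,f_l\rangle|=\sqrt{\frac{N-m}{m(N-1)}}$. *)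

theory Defs
  imports "HOL-Analysis.Analysis"
begin

text \<open>The type \<^typ>\<open>complex ^ 'm\<close> has the Euclidean norm of the library, but the library's
  \<^const>\<open>inner\<close> on it is only the real part of the Hermitian inner product.\<close>

definition cinner :: "complex ^ 'm \<Rightarrow> complex ^ 'm \<Rightarrow> complex" where
  "cinner x y = (\<Sum>i\<in>UNIV. x $ i * cnj (y $ i))"

lemma cinner_self: "cinner x x = of_real ((norm x)\<^sup>2)"
  by (simp add: cinner_def norm_vec_def L2_set_def sum_nonneg complex_norm_square del: of_real_power)

text \<open>The definitions below take the inner product \<open>ip\<close> of the space \<open>'a ^ 'm\<close> as an argument; it is
  \<^const>\<open>inner\<close> on \<^typ>\<open>real ^ 'm\<close> and \<^const>\<open>cinner\<close> on \<^typ>\<open>complex ^ 'm\<close>.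
  A sequence of \<open>N\<close> vectors is a function \<open>f\<close> on \<^typ>\<open>nat\<close> of which only the values at
  \<open>1, \<dots>, N\<close> matter.\<close>

definition frame_bounds ::
    "('a::real_normed_field ^ 'm \<Rightarrow> 'a ^ 'm \<Rightarrow> 'a) \<Rightarrow> nat \<Rightarrow> (nat \<Rightarrow> 'a ^ 'm) \<Rightarrow> real \<Rightarrow> real \<Rightarrow> bool" where
  "frame_bounds ip N f A B \<longleftrightarrow> A > 0 \<and> B > 0 \<and>
     (\<forall>v. A * (norm v)\<^sup>2 \<le> (\<Sum>k=1..N. (norm (ip v (f k)))\<^sup>2) \<and>
          (\<Sum>k=1..N. (norm (ip v (f k)))\<^sup>2) \<le> B * (norm v)\<^sup>2)"

definition is_frame ::
    "('a::real_normed_field ^ 'm \<Rightarrow> 'a ^ 'm \<Rightarrow> 'a) \<Rightarrow> nat \<Rightarrow> (nat \<Rightarrow> 'a ^ 'm) \<Rightarrow> bool" where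
  "is_frame ip N f \<longleftrightarrow> (\<exists>A B. frame_bounds ip N f A B)"

definition tight_frame ::
    "('a::real_normed_field ^ 'm \<Rightarrow> 'a ^ 'm \<Rightarrow> 'a) \<Rightarrow> nat \<Rightarrow> (nat \<Rightarrow> 'a ^ 'm) \<Rightarrow> bool" where
  "tight_frame ip N f \<longleftrightarrow> (\<exists>A. frame_bounds ip N f A A)"

definition uniform_frame ::
    "('a::real_normed_field ^ 'm \<Rightarrow> 'a ^ 'm \<Rightarrow> 'a) \<Rightarrow> nat \<Rightarrow> (nat \<Rightarrow> 'a ^ 'm) \<Rightarrow> bool" where
  "uniform_frame ip N f \<longleftrightarrow> is_frame ip N f \<and> (\<forall>k\<in>{1..N}. norm (f k) = 1)"

definition max_correlation ::
    "('a::real_normed_field ^ 'm \<Rightarrow> 'a ^ 'm \<Rightarrow> 'a) \<Rightarrow> nat \<Rightarrow> (nat \<Rightarrow> 'a ^ 'm) \<Rightarrow> real" where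
  "max_correlation ip N f =
     Max {norm (ip (f k) (f l)) | k l. k \<in> {1..N} \<and> l \<in> {1..N} \<and> k \<noteq> l}"

text \<open>The condition \<open>N \<ge> 2\<close> makes the maximum range over a nonempty set.\<close>

definition optimal_grassmannian_frame ::
    "('a::real_normed_field ^ 'm \<Rightarrow> 'a ^ 'm \<Rightarrow> 'a) \<Rightarrow> nat \<Rightarrow> (nat \<Rightarrow> 'a ^ 'm) \<Rightarrow> bool" where
  "optimal_grassmannian_frame ip N f \<longleftrightarrow> N \<ge> 2 \<and> uniform_frame ip N f \<and>
     max_correlation ip N f =
       sqrt ((real N - real CARD('m)) / (real CARD('m) * (real N - 1)))"

end

theory Submission imports Defs begin

text \<open>
  For \<open>N = m + 1\<close> the bound in the definition of an optimal Grassmannian frame is \<open>1 / m\<close>.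
  Real frames are complexified, so only \<open>\<complex>\<^sup>m\<close> matters. Let \<open>S\<close> be the frame operator and \<open>G\<close> the
  Gram matrix, with \<open>(k, l)\<close> entry \<open>\<langle>f\<^sub>l, f\<^sub>k\<rangle>\<close>, of \<open>N\<close> unit vectors; they have the same Frobenius norm, and \<open>S\<close> has trace \<open>N\<close>.
  If all correlations are at most \<open>1 / m\<close>, then the squared Frobenius norm of \<open>S - (N / m) I\<close>, which
  is that of \<open>G\<close> minus \<open>N\<^sup>2 / m\<close>, is at most 0, so the frame is tight.
  Conversely, tightness forces the frame bound \<open>N / m\<close> and makes \<open>P = I - (m / N) G\<close> have
  Frobenius norm 1. The \<open>m + 1\<close> vectors are linearly dependent, which gives a unit vector
  \<open>c\<close> with \<open>G c = 0\<close>; hence \<open>\<parallel>P - c c\<^sup>*\<parallel>\<^sup>2 = 1 - 2 + 1 = 0\<close> and \<open>P = c c\<^sup>*\<close>. The diagonal of \<open>P\<close> gives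
  \<open>\<bar>c\<^sub>k\<bar>\<^sup>2 = 1 / N\<close>, so all the off-diagonal entries of \<open>P\<close> have modulus \<open>1 / N\<close>.
\<close>

section \<open>Moduli and the Hermitian product in coordinates\<close>

lemma cmod_diff_square:
  "(cmod (a - b))\<^sup>2 = (cmod a)\<^sup>2 - 2 * Re (a * cnj b) + (cmod b)\<^sup>2"
  by (simp only: cmod_power2) (simp add: power2_eq_square algebra_simps)

lemma norm_vec_complex_square: "(norm (x :: complex ^ 'm))\<^sup>2 = (\<Sum>i\<in>UNIV. (cmod (x $ i))\<^sup>2)"
  by (simp add: norm_vec_def L2_set_def sum_nonneg)

lemma cnj_cinner: "cnj (cinner x y) = cinner y x"
  by (simp add: cinner_def mult.commute)

section \<open>The frame operator and its Frobenius norm\<close>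

definition frame_operator :: "'k set \<Rightarrow> ('k \<Rightarrow> complex ^ 'm) \<Rightarrow> 'm \<Rightarrow> 'm \<Rightarrow> complex" where
  "frame_operator K g i j = (\<Sum>k\<in>K. g k $ i * cnj (g k $ j))"

text \<open>The quadratic form \<open>\<langle>S v, v\<rangle>\<close> of the frame operator in
  coordinates, stated over the complex numbers so that each squared modulus expands as
  \<open>z * cnj z\<close>.\<close>

lemma sum_cmod_cinner_square:
  "complex_of_real (\<Sum>k\<in>K. (cmod (cinner v (g k)))\<^sup>2) =
     (\<Sum>i\<in>UNIV. \<Sum>j\<in>UNIV. v $ i * cnj (v $ j) * frame_operator K g j i)"
proof -
  have "complex_of_real (\<Sum>k\<in>K. (cmod (cinner v (g k)))\<^sup>2) =
      (\<Sum>k\<in>K. \<Sum>i\<in>UNIV. \<Sum>j\<in>UNIV. v $ i * cnj (v $ j) * (g k $ j * cnj (g k $ i)))"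
    by (simp add: complex_norm_square cinner_def sum_product mult_ac
        del: of_real_power)
  also have "\<dots> = (\<Sum>i\<in>UNIV. \<Sum>j\<in>UNIV. \<Sum>k\<in>K. v $ i * cnj (v $ j) * (g k $ j * cnj (g k $ i)))"
    by (subst sum.swap) (intro sum.cong refl sum.swap)
  finally show ?thesis by (simp add: frame_operator_def sum_distrib_left)
qed

text \<open>Summing the quadratic form over \<open>v = g k\<close> collects the coordinates of
  \<open>v\<close> into a second copy of \<open>S\<close>. The result is the trace of
  \<open>S * S\<close>, which is the squared Frobenius norm because \<open>S\<close> is
  Hermitian.\<close>

lemma frame_potential:
  "(\<Sum>k\<in>K. \<Sum>l\<in>K. (cmod (cinner (g k) (g l)))\<^sup>2) =
     (\<Sum>i\<in>UNIV. \<Sum>j\<in>UNIV. (cmod (frame_operator K g i j))\<^sup>2)"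
proof -
  have cnj_S: "cnj (frame_operator K g i j) = frame_operator K g j i" for i j
    by (simp add: frame_operator_def mult.commute)
  have "complex_of_real (\<Sum>k\<in>K. \<Sum>l\<in>K. (cmod (cinner (g k) (g l)))\<^sup>2) =
     (\<Sum>k\<in>K. \<Sum>i\<in>UNIV. \<Sum>j\<in>UNIV. g k $ i * cnj (g k $ j) * frame_operator K g j i)"
    by (subst of_real_sum) (simp only: sum_cmod_cinner_square)
  also have "\<dots> = (\<Sum>i\<in>UNIV. \<Sum>j\<in>UNIV. \<Sum>k\<in>K. g k $ i * cnj (g k $ j) * frame_operator K g j i)"
    by (subst sum.swap) (intro sum.cong refl sum.swap)
  also have "\<dots> = (\<Sum>i\<in>UNIV. \<Sum>j\<in>UNIV. frame_operator K g i j * frame_operator K g j i)"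
    by (simp only: frame_operator_def [of K g "i" "j" for i j] sum_distrib_right)
  also have "\<dots> = complex_of_real (\<Sum>i\<in>UNIV. \<Sum>j\<in>UNIV. (cmod (frame_operator K g i j))\<^sup>2)"
    by (simp add: complex_norm_square cnj_S del: of_real_power)
  finally show ?thesis by (simp only: of_real_eq_iff)
qed

lemma trace_frame_operator:
  "(\<Sum>i\<in>UNIV. frame_operator K g i i) = of_real (\<Sum>k\<in>K. (norm (g k))\<^sup>2)"
proof -
  have "(\<Sum>i\<in>UNIV. frame_operator K g i i) = (\<Sum>k\<in>K. cinner (g k) (g k))"
    unfolding frame_operator_def cinner_def by (rule sum.swap)
  then show ?thesis by (simp add: cinner_self)
qed

lemma tight_if_frame_potential_le:
  fixes g :: "'k \<Rightarrow> complex ^ 'm"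
  assumes unit: "\<And>k. k \<in> K \<Longrightarrow> norm (g k) = 1"
    and le: "(\<Sum>k\<in>K. \<Sum>l\<in>K. (cmod (cinner (g k) (g l)))\<^sup>2) \<le> (real (card K))\<^sup>2 / real CARD('m)"
  shows "(\<Sum>k\<in>K. (cmod (cinner v (g k)))\<^sup>2) = real (card K) / real CARD('m) * (norm v)\<^sup>2"
proof -
  let ?S = "frame_operator K g"
  \<comment> \<open>The scalar with the same trace as \<open>S\<close>, hence the only candidate for
    a frame bound.\<close>
  define a where "a = real (card K) / real CARD('m)"
  define D :: "'m \<Rightarrow> 'm \<Rightarrow> complex" where "D i j = (if i = j then of_real a else 0)" for i j
  have tr: "(\<Sum>i\<in>UNIV. Re (?S i i)) = real (card K)"
    using arg_cong[OF trace_frame_operator[of K g], of Re] unit by simp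
  \<comment> \<open>\<open>D\<close> is diagonal, so the cross term sees only the trace of
    \<open>S\<close>.\<close>
  have "(\<Sum>i\<in>UNIV. \<Sum>j\<in>UNIV. (cmod (?S i j - D i j))\<^sup>2) =
      (\<Sum>i\<in>UNIV. \<Sum>j\<in>UNIV. (cmod (?S i j))\<^sup>2 - (if i = j then 2 * a * Re (?S i j) - a\<^sup>2 else 0))"
    by (intro sum.cong refl) (simp add: cmod_diff_square D_def)
  also have "\<dots> = (\<Sum>i\<in>UNIV. \<Sum>j\<in>UNIV. (cmod (?S i j))\<^sup>2)
      - (2 * a * (\<Sum>i\<in>UNIV. Re (?S i i)) - real CARD('m) * a\<^sup>2)"
    by (simp add: sum_subtractf sum_distrib_left)
  also have "\<dots> = (\<Sum>i\<in>UNIV. \<Sum>j\<in>UNIV. (cmod (?S i j))\<^sup>2) - (real (card K))\<^sup>2 / real CARD('m)"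
    unfolding tr a_def by (simp add: field_simps power2_eq_square)
  also have "\<dots> \<le> 0" using le by (simp add: frame_potential)
  finally have "(\<Sum>i\<in>UNIV. \<Sum>j\<in>UNIV. (cmod (?S i j - D i j))\<^sup>2) = 0"
    by (intro antisym) (simp_all add: sum_nonneg)
  then have S: "?S i j = D i j" for i j
    by (simp add: sum_nonneg_eq_0_iff sum_nonneg)
  have "complex_of_real (\<Sum>k\<in>K. (cmod (cinner v (g k)))\<^sup>2) = of_real a * cinner v v"
    unfolding sum_cmod_cinner_square S D_def
    by (simp add: cinner_def if_distrib[of "(*) _"] sum_distrib_left mult_ac cong: if_cong)
  then have "complex_of_real (\<Sum>k\<in>K. (cmod (cinner v (g k)))\<^sup>2) = of_real (a * (norm v)\<^sup>2)"
    by (simp only: cinner_self of_real_mult)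
  then show ?thesis by (simp only: of_real_eq_iff a_def)
qed

section \<open>Linear dependence of more than m vectors\<close>

lemma linear_dependence_of_family:
  fixes g :: "'k \<Rightarrow> 'a::field ^ 'm"
  assumes "finite K" and card: "card K > CARD('m)"
  obtains c where "(\<Sum>k\<in>K. c k *s g k) = 0" and "\<exists>k\<in>K. c k \<noteq> 0"
proof (cases "inj_on g K")
  case True
  then have "vec.dependent (g ` K)"
    using vec.independent_card_le_dim[of "g ` K" UNIV] card by (auto simp: card_image vec_dim_card card_cart_basis)
  then obtain u where u: "(\<Sum>v\<in>g ` K. u v *s v) = 0" "\<exists>v\<in>g ` K. u v \<noteq> 0"
    using vec.dependent_finite[of "g ` K"] \<open>finite K\<close> by auto
  show ?thesis
    by (rule that[of "u \<circ> g"]) (use u in \<open>simp_all add: sum.reindex[OF True]\<close>)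
next
  case False
  then obtain k l where kl: "k \<in> K" "l \<in> K" "k \<noteq> l" "g k = g l"
    by (auto simp: inj_on_def)
  \<comment> \<open>Written as a sum of two conditionals so that the combination splits into two
    single-term sums.\<close>
  let ?c = "\<lambda>i. (if i = k then 1 else 0) + (if i = l then -1 else 0) :: 'a"
  show ?thesis
  proof (rule that[of ?c])
    have "(\<Sum>i\<in>K. ?c i *s g i) =
        (\<Sum>i\<in>K. (if i = k then g i else 0) + (if i = l then - g i else 0))"
      by (intro sum.cong refl) (simp add: vec_eq_iff)
    then show "(\<Sum>i\<in>K. ?c i *s g i) = 0"
      using kl \<open>finite K\<close> by (simp add: sum.distrib)
    show "\<exists>i\<in>K. ?c i \<noteq> 0" using kl by (intro bexI[of _ k]) auto
  qed
qed

lemma unit_linear_dependence: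
  fixes g :: "'k \<Rightarrow> complex ^ 'm"
  assumes "finite K" and "card K > CARD('m)"
  obtains c where "(\<Sum>k\<in>K. c k *s g k) = 0" and "(\<Sum>k\<in>K. (cmod (c k))\<^sup>2) = 1"
proof -
  obtain c where c: "(\<Sum>k\<in>K. c k *s g k) = 0" "\<exists>k\<in>K. c k \<noteq> 0"
    using linear_dependence_of_family[OF assms] .
  define s where "s = sqrt (\<Sum>k\<in>K. (cmod (c k))\<^sup>2)"
  have pos: "(\<Sum>k\<in>K. (cmod (c k))\<^sup>2) > 0"
    using c(2) \<open>finite K\<close> by (auto intro: sum_pos2)
  then have s2: "s\<^sup>2 = (\<Sum>k\<in>K. (cmod (c k))\<^sup>2)" by (simp add: s_def)
  show ?thesis
  proof (rule that[of "\<lambda>k. inverse (of_real s) * c k"])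
    have "(\<Sum>k\<in>K. (inverse (of_real s) * c k) *s g k) = inverse (of_real s) *s (\<Sum>k\<in>K. c k *s g k)"
      by (simp add: vec.scale_sum_right)
    then show "(\<Sum>k\<in>K. (inverse (of_real s) * c k) *s g k) = 0" using c(1) by simp
    have "(\<Sum>k\<in>K. (cmod (inverse (of_real s) * c k))\<^sup>2) = inverse (s\<^sup>2) * (\<Sum>k\<in>K. (cmod (c k))\<^sup>2)"
      by (simp add: norm_mult norm_inverse power_mult_distrib sum_distrib_left power_inverse)
    then show "(\<Sum>k\<in>K. (cmod (inverse (of_real s) * c k))\<^sup>2) = 1" using pos s2 by simp
  qed
qed

section \<open>Tight frames of m + 1 unit vectors are equiangular\<close>

text \<open>Tightness tested on the standard basis vector \<open>axis i 1\<close> bounds nothing but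
  coordinate \<open>i\<close>: the squares \<open>(cmod (g k $ i))\<^sup>2\<close> sum to
  \<open>A\<close>. Summing over \<open>i\<close> gives the claim.\<close>

lemma tight_frame_bound:
  fixes g :: "'k \<Rightarrow> complex ^ 'm"
  assumes tight: "\<And>v. (\<Sum>k\<in>K. (cmod (cinner v (g k)))\<^sup>2) = A * (norm v)\<^sup>2"
  shows "(\<Sum>k\<in>K. (norm (g k))\<^sup>2) = real CARD('m) * A"
proof -
  have ax: "cinner (axis i 1) x = cnj (x $ i)" for i and x :: "complex ^ 'm"
    by (simp add: cinner_def axis_def if_distrib[of "\<lambda>z. z * _"] cong: if_cong)
  have ax_norm: "norm (axis i (1 :: complex)) = 1" for i :: 'm
    by (simp add: norm_eq_1 inner_axis)
  have "(\<Sum>k\<in>K. (cmod (g k $ i))\<^sup>2) = A" for i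
    using tight[of "axis i 1"] ax_norm by (simp add: ax)
  then have "(\<Sum>i\<in>(UNIV :: 'm set). \<Sum>k\<in>K. (cmod (g k $ i))\<^sup>2) = real CARD('m) * A"
    by simp
  then show ?thesis by (subst (asm) sum.swap) (simp add: norm_vec_complex_square)
qed

lemma equiangular_if_tight:
  fixes g :: "'k \<Rightarrow> complex ^ 'm"
  assumes K: "finite K" "card K = CARD('m) + 1"
    and unit: "\<And>k. k \<in> K \<Longrightarrow> norm (g k) = 1"
    and tight: "\<And>v. (\<Sum>k\<in>K. (cmod (cinner v (g k)))\<^sup>2) = A * (norm v)\<^sup>2"
    and kl: "k \<in> K" "l \<in> K" "k \<noteq> l"
  shows "cmod (cinner (g k) (g l)) = 1 / real CARD('m)"
proof -
  define m where "m = real CARD('m)"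
  have m: "m > 0" by (simp add: m_def)
  have cardK: "real (card K) = m + 1" by (simp add: K m_def)
  have A: "m * A = m + 1"
    using tight_frame_bound[OF tight] unit cardK by (simp add: m_def)
  then have Apos: "A > 0" using m by (metis add_pos_pos zero_less_mult_pos zero_less_one)
  \<comment> \<open>Since \<open>1 / A = m / (m + 1)\<close>, this is \<open>I - (m / N) G\<close>
    with the two indices exchanged; the rank-one matrix to compare it with is therefore
    \<open>cnj (c k) * c l\<close>.\<close>
  define P where "P k l = (if k = l then 1 else 0) - cinner (g k) (g l) / of_real A" for k l
  obtain c where c: "(\<Sum>k\<in>K. c k *s g k) = 0" and c1: "(\<Sum>k\<in>K. (cmod (c k))\<^sup>2) = 1"
    using unit_linear_dependence[of K g] K by auto
  have P_norm: "(\<Sum>k\<in>K. \<Sum>l\<in>K. (cmod (P k l))\<^sup>2) = 1"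
  proof -
    have "(\<Sum>l\<in>K. (cmod (P k l))\<^sup>2) = 1 - 1 / A" if k: "k \<in> K" for k
    proof -
      \<comment> \<open>On the diagonal \<open>(1 - 1 / A)\<^sup>2\<close> is
        \<open>1 - 2 / A\<close> plus the term \<open>1 / A\<^sup>2\<close> already present in the
        second summand. Tightness at \<open>v = g k\<close> then makes the row sum of squared
        correlations equal to \<open>A\<close>.\<close>
      have "(cmod (P k l))\<^sup>2 =
          (if k = l then 1 - 2 / A else 0) + (cmod (cinner (g k) (g l)))\<^sup>2 / A\<^sup>2" for l
        using Apos k unit unfolding P_def cmod_diff_square
        by (auto simp: cinner_self cnj_cinner norm_divide power_divide)
      then have "(\<Sum>l\<in>K. (cmod (P k l))\<^sup>2) =
          1 - 2 / A + (\<Sum>l\<in>K. (cmod (cinner (g k) (g l)))\<^sup>2) / A\<^sup>2"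
        using K k by (simp add: sum.distrib sum_divide_distrib)
      also have "\<dots> = 1 - 1 / A"
        unfolding tight using Apos unit[OF k] by (simp add: field_simps power2_eq_square)
      finally show ?thesis .
    qed
    then have "(\<Sum>k\<in>K. \<Sum>l\<in>K. (cmod (P k l))\<^sup>2) = (m + 1) * (1 - 1 / A)"
      by (simp add: cardK)
    \<comment> \<open>From \<open>m * A = m + 1\<close> follows
      \<open>1 - 1 / A = 1 / (m + 1)\<close>.\<close>
    also have "\<dots> = 1" using A Apos by (simp add: field_simps)
    finally show ?thesis .
  qed
  have Gc: "(\<Sum>k\<in>K. c k * cinner (g k) x) = 0" for x
  proof -
    have "(\<Sum>k\<in>K. c k * cinner (g k) x) = cinner (\<Sum>k\<in>K. c k *s g k) x"
      unfolding cinner_def by (simp add: sum_distrib_left sum_distrib_right mult.assoc, rule sum.swap)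
    then show ?thesis by (simp add: c cinner_def)
  qed
  have Pc: "(\<Sum>k\<in>K. c k * P k l) = c l" if "l \<in> K" for l
  proof -
    have "(\<Sum>k\<in>K. c k * P k l) =
        (\<Sum>k\<in>K. if k = l then c k else 0) - (\<Sum>k\<in>K. c k * cinner (g k) (g l)) / of_real A"
      unfolding sum_divide_distrib sum_subtractf[symmetric] P_def
      by (intro sum.cong refl) (simp add: algebra_simps)
    then show ?thesis using that K Gc by simp
  qed
  have cPc: "(\<Sum>k\<in>K. \<Sum>l\<in>K. P k l * (c k * cnj (c l))) = 1"
  proof -
    have "(\<Sum>k\<in>K. \<Sum>l\<in>K. P k l * (c k * cnj (c l))) = (\<Sum>l\<in>K. \<Sum>k\<in>K. P k l * (c k * cnj (c l)))"
      by (rule sum.swap)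
    also have "\<dots> = (\<Sum>l\<in>K. (\<Sum>k\<in>K. c k * P k l) * cnj (c l))"
      by (simp add: sum_distrib_left mult_ac)
    also have "\<dots> = (\<Sum>l\<in>K. c l * cnj (c l))" using Pc by simp
    also have "\<dots> = of_real (\<Sum>l\<in>K. (cmod (c l))\<^sup>2)"
      by (simp add: complex_norm_square del: of_real_power)
    finally show ?thesis by (simp add: c1)
  qed
  have cc: "(\<Sum>k\<in>K. \<Sum>l\<in>K. (cmod (c k * cnj (c l)))\<^sup>2) = 1"
    by (simp add: norm_mult power_mult_distrib sum_product[symmetric] c1)
  \<comment> \<open>Conjugating \<open>cnj (c k) * c l\<close> turns the cross term into the sum in
    \<open>cPc\<close>, so the three parts are 1, -2 and 1.\<close>
  have "(\<Sum>k\<in>K. \<Sum>l\<in>K. (cmod (P k l - cnj (c k) * c l))\<^sup>2) =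
      (\<Sum>k\<in>K. \<Sum>l\<in>K. (cmod (P k l))\<^sup>2)
      - 2 * Re (\<Sum>k\<in>K. \<Sum>l\<in>K. P k l * (c k * cnj (c l)))
      + (\<Sum>k\<in>K. \<Sum>l\<in>K. (cmod (c k * cnj (c l)))\<^sup>2)"
    unfolding cmod_diff_square
    by (simp add: sum.distrib sum_subtractf sum_distrib_left norm_mult del: complex_Re_numeral times_complex.sel)
  also have "\<dots> = 0" by (simp only: P_norm cPc cc) simp
  finally have P_eq: "P k l = cnj (c k) * c l" if "k \<in> K" "l \<in> K" for k l
    using K that by (simp add: sum_nonneg_eq_0_iff sum_nonneg)
  have c_eq: "(cmod (c k))\<^sup>2 = 1 - 1 / A" if k: "k \<in> K" for k
  proof -
    have "of_real ((cmod (c k))\<^sup>2) = P k k"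
      using P_eq[OF k k] by (simp add: complex_norm_square mult.commute del: of_real_power)
    also have "\<dots> = of_real (1 - 1 / A)" by (simp add: P_def cinner_self unit[OF k])
    finally show ?thesis by (simp only: of_real_eq_iff)
  qed
  have "cmod (c k) = cmod (c l)"
    by (rule power2_eq_imp_eq) (simp_all add: c_eq kl)
  then have "cmod (P k l) = 1 - 1 / A"
    using c_eq[OF kl(1)] by (simp add: P_eq kl norm_mult power2_eq_square)
  \<comment> \<open>Off the diagonal \<open>P\<close> is just the scaled Gram entry; comparing the
    two values of its modulus gives the correlation \<open>A - 1\<close>.\<close>
  moreover have "cmod (P k l) = cmod (cinner (g k) (g l)) / A"
    using kl Apos by (simp add: P_def norm_divide)
  ultimately have "cmod (cinner (g k) (g l)) = A - 1"
    using Apos by (simp add: field_simps)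
  moreover have "A - 1 = 1 / m" using A m by (simp add: field_simps)
  ultimately show ?thesis by (simp add: m_def)
qed

section \<open>The maximal correlation and the complex case\<close>

lemma max_correlation_ge:
  assumes "k \<in> {1..N}" "l \<in> {1..N}" "k \<noteq> l"
  shows "norm (ip (f k) (f l)) \<le> max_correlation ip N f"
proof -
  have "finite {norm (ip (f k) (f l)) | k l. k \<in> {1..N} \<and> l \<in> {1..N} \<and> k \<noteq> l}"
    by (rule finite_subset[of _ "(\<lambda>(k, l). norm (ip (f k) (f l))) ` ({1..N} \<times> {1..N})"]) auto
  then show ?thesis unfolding max_correlation_def using assms by (intro Max_ge) auto
qed

lemma max_correlation_const:
  assumes "N \<ge> 2" and eq: "\<And>k l. k \<in> {1..N} \<Longrightarrow> l \<in> {1..N} \<Longrightarrow> k \<noteq> l \<Longrightarrow> norm (ip (f k) (f l)) = a"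
  shows "max_correlation ip N f = a"
proof -
  have "{norm (ip (f k) (f l)) | k l. k \<in> {1..N} \<and> l \<in> {1..N} \<and> k \<noteq> l} = {a}" (is "?L = _")
  proof
    show "?L \<subseteq> {a}" using eq by auto
    have "norm (ip (f 1) (f 2)) \<in> ?L" using \<open>N \<ge> 2\<close> by (intro CollectI exI[of _ 1] exI[of _ 2]) auto
    then show "{a} \<subseteq> ?L" using eq[of 1 2] \<open>N \<ge> 2\<close> by auto
  qed
  then show ?thesis by (simp add: max_correlation_def)
qed

lemma optimal_grassmannian_frame_complex_iff:
  fixes g :: "nat \<Rightarrow> complex ^ 'm"
  assumes N: "N = CARD('m) + 1"
  shows "optimal_grassmannian_frame cinner N g \<longleftrightarrow>
    uniform_frame cinner N g \<and> tight_frame cinner N g"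
proof -
  define m where "m = real CARD('m)"
  have m: "m > 0" by (simp add: m_def)
  have "CARD('m) \<ge> 1" by (simp add: Suc_leI)
  then have N2: "N \<ge> 2" using N by simp
  \<comment> \<open>Here \<open>N - m = 1\<close> and \<open>N - 1 = m\<close>, so the radicand is
    \<open>1 / m\<^sup>2\<close>.\<close>
  have bound: "sqrt ((real N - real CARD('m)) / (real CARD('m) * (real N - 1))) = 1 / m"
    using m by (simp add: N m_def real_sqrt_divide)
  show ?thesis
  proof
    assume opt: "optimal_grassmannian_frame cinner N g"
    then have uni: "uniform_frame cinner N g" and max: "max_correlation cinner N g = 1 / m"
      unfolding optimal_grassmannian_frame_def bound by auto
    have unit: "norm (g k) = 1" if "k \<in> {1..N}" for k
      using uni that by (simp add: uniform_frame_def)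
    \<comment> \<open>One diagonal term equal to 1 and \<open>m\<close> further terms of at most
      \<open>1 / m\<^sup>2\<close> each.\<close>
    have row: "(\<Sum>l=1..N. (cmod (cinner (g k) (g l)))\<^sup>2) \<le> 1 + 1 / m" if k: "k \<in> {1..N}" for k
    proof -
      have "(\<Sum>l=1..N. (cmod (cinner (g k) (g l)))\<^sup>2) =
          1 + (\<Sum>l\<in>{1..N} - {k}. (cmod (cinner (g k) (g l)))\<^sup>2)"
        using k by (subst sum.remove[of _ k]) (auto simp: cinner_self unit)
      also have "\<dots> \<le> 1 + (\<Sum>l\<in>{1..N} - {k}. (1 / m)\<^sup>2)"
        using max_correlation_ge[of k N _ cinner g] k
        by (intro add_mono order.refl sum_mono power_mono) (auto simp: max)
      also have "\<dots> = 1 + 1 / m"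
        using k m by (simp add: N m_def power2_eq_square)
      finally show ?thesis .
    qed
    have "(\<Sum>k=1..N. \<Sum>l=1..N. (cmod (cinner (g k) (g l)))\<^sup>2) \<le> (\<Sum>k=1..N. 1 + 1 / m)"
      by (intro sum_mono row)
    \<comment> \<open>\<open>1 + 1 / m = N / m\<close>, so the \<open>N\<close> rows add up to
      exactly the threshold for tightness.\<close>
    also have "\<dots> = (real (card {1..N}))\<^sup>2 / real CARD('m)"
      using m by (simp add: N m_def field_simps power2_eq_square)
    finally have "(\<Sum>k=1..N. (cmod (cinner v (g k)))\<^sup>2) = real N / m * (norm v)\<^sup>2" for v
      using tight_if_frame_potential_le[of "{1..N}" g v] unit by (simp add: m_def)
    then have "frame_bounds cinner N g (real N / m) (real N / m)"
      using m N2 by (simp add: frame_bounds_def)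
    with uni show "uniform_frame cinner N g \<and> tight_frame cinner N g"
      by (auto simp: tight_frame_def)
  next
    assume asm: "uniform_frame cinner N g \<and> tight_frame cinner N g"
    then obtain A where "frame_bounds cinner N g A A" by (auto simp: tight_frame_def)
    then have tight: "(\<Sum>k=1..N. (cmod (cinner v (g k)))\<^sup>2) = A * (norm v)\<^sup>2" for v
      by (auto simp: frame_bounds_def intro: antisym)
    have "max_correlation cinner N g = 1 / m"
      unfolding m_def
      by (intro max_correlation_const[OF N2] equiangular_if_tight[of "{1..N}" _ A] tight)
        (use asm N in \<open>auto simp: uniform_frame_def\<close>)
    then show "optimal_grassmannian_frame cinner N g"
      using asm N2 unfolding optimal_grassmannian_frame_def bound by simp
  qed
qed

section \<open>Reduction of the real case to the complex case\<close>

definition complexify :: "real ^ 'm \<Rightarrow> complex ^ 'm" where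
  "complexify x = (\<chi> i. of_real (x $ i))"

lemma cinner_complexify: "cinner (complexify x) (complexify y) = of_real (inner x y)"
  by (simp add: cinner_def complexify_def inner_vec_def)

lemma norm_complexify: "norm (complexify x) = norm x"
  by (simp add: complexify_def norm_vec_def)

text \<open>Conjugation fixes the coordinates of \<open>complexify x\<close>, so the real and
  imaginary parts of \<open>v\<close> pair with \<open>x\<close> separately.\<close>

lemma cmod_cinner_complexify_square:
  "(cmod (cinner v (complexify x)))\<^sup>2 = (inner (\<chi> i. Re (v $ i)) x)\<^sup>2 + (inner (\<chi> i. Im (v $ i)) x)\<^sup>2"
  by (simp add: cmod_power2 cinner_def complexify_def inner_vec_def)

lemma norm_square_Re_Im:
  "(norm (v :: complex ^ 'm))\<^sup>2 = (norm (\<chi> i. Re (v $ i)))\<^sup>2 + (norm (\<chi> i. Im (v $ i)))\<^sup>2"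
  by (simp add: norm_vec_def L2_set_def sum_nonneg cmod_power2 sum.distrib)

text \<open>The complex bounds specialise to vectors \<open>complexify x\<close>. Conversely, the
  real bounds at the real and imaginary parts of \<open>v\<close> add up to the complex bounds at
  \<open>v\<close>, with the same constants.\<close>

lemma frame_bounds_complexify:
  "frame_bounds cinner N (\<lambda>k. complexify (f k)) A B \<longleftrightarrow> frame_bounds inner N f A B"
proof
  assume l: "frame_bounds cinner N (\<lambda>k. complexify (f k)) A B"
  have "A * (norm x)\<^sup>2 \<le> (\<Sum>k=1..N. (norm (inner x (f k)))\<^sup>2) \<and>
      (\<Sum>k=1..N. (norm (inner x (f k)))\<^sup>2) \<le> B * (norm x)\<^sup>2" for x
    using l unfolding frame_bounds_def
    by (auto simp: cinner_complexify norm_complexify dest: spec[of _ "complexify x"])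
  with l show "frame_bounds inner N f A B" by (simp add: frame_bounds_def)
next
  assume r: "frame_bounds inner N f A B"
  have "A * (norm v)\<^sup>2 \<le> (\<Sum>k=1..N. (cmod (cinner v (complexify (f k))))\<^sup>2) \<and>
      (\<Sum>k=1..N. (cmod (cinner v (complexify (f k))))\<^sup>2) \<le> B * (norm v)\<^sup>2" for v
    unfolding cmod_cinner_complexify_square norm_square_Re_Im[of v] sum.distrib distrib_left
    using r unfolding frame_bounds_def by (auto intro!: add_mono)
  with r show "frame_bounds cinner N (\<lambda>k. complexify (f k)) A B" by (simp add: frame_bounds_def)
qed

lemma tight_frame_complexify:
  "tight_frame cinner N (\<lambda>k. complexify (f k)) \<longleftrightarrow> tight_frame inner N f"
  by (simp add: tight_frame_def frame_bounds_complexify)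

lemma uniform_frame_complexify:
  "uniform_frame cinner N (\<lambda>k. complexify (f k)) \<longleftrightarrow> uniform_frame inner N f"
  by (simp add: uniform_frame_def is_frame_def frame_bounds_complexify norm_complexify)

lemma optimal_grassmannian_frame_complexify:
  "optimal_grassmannian_frame cinner N (\<lambda>k. complexify (f k)) \<longleftrightarrow> optimal_grassmannian_frame inner N f"
  by (simp add: optimal_grassmannian_frame_def uniform_frame_complexify max_correlation_def
      cinner_complexify)

theorem corollary2p5:
  fixes f :: "nat \<Rightarrow> real ^ 'm" and g :: "nat \<Rightarrow> complex ^ 'm" and N :: nat
  assumes "N = CARD('m) + 1"
  shows "(optimal_grassmannian_frame inner N f \<longleftrightarrow>
            uniform_frame inner N f \<and> tight_frame inner N f) \<and>
         (optimal_grassmannian_frame cinner N g \<longleftrightarrow>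
            uniform_frame cinner N g \<and> tight_frame cinner N g)"
  using optimal_grassmannian_frame_complex_iff[OF assms, of g]
    optimal_grassmannian_frame_complex_iff[OF assms, of "\<lambda>k. complexify (f k)"]
  by (simp add: optimal_grassmannian_frame_complexify uniform_frame_complexify
      tight_frame_complexify)

end
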